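(* Let $\alpha>0$ be a real number. The map $$P_\alpha:(0,1)\to(0,1):\ x\mapsto \exp(1-x^{-\alpha})$$ is $(A,e,1/\alpha)$-mild, where $A=6\alpha$ if $\alpha\ge 1$ and $A=3\,(2/\alpha)^{1/\alpha}$ if $0<\alpha<1$.
   Context: Mild functions: let $U\subset(0,1)^m$ be open, $f\in C^\infty(U,\mathbb{R})$, $A,B\in\mathbb{R}_{>0}$ and $C\in\mathbb{R}_{\ge 0}$. The function $f$ is called $(A,B,C)$-mild if for every $x\in U$ and every $\nu\in\mathbb{N}^m$ (with $0\in\mathbb{N}$), $$|f^{(\nu)}(x)|\le B\,A^{|\nu|}(|\nu|!)^{C+1},$$ where $|\nu|=\nu_1+\cdots+\nu_m$ and $f^{(\nu)}=\frac{\partial^{|\nu|}f}{\partial x_1^{\nu_1}\cdots\partial x_m^{\nu_m}}$. Here $m=1$ and $U=(0,1)$; $e$ denotes Euler's number. *)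

theory Defs
  imports "HOL-Analysis.Analysis"
begin

text \<open>
  The ambient space \<open>\<real>\<^sup>m\<close> is a type of class \<open>euclidean_space\<close>, with the coordinate directions
  given by \<open>Basis\<close>; the case \<open>m = 1\<close> is the type \<open>real\<close> itself, where \<open>Basis = {1}\<close>.
  Functions on an open set \<open>U\<close> are total functions of which only the values on \<open>U\<close> matter:
  for open \<open>U\<close>, all derivatives at points of \<open>U\<close> depend only on these values.
\<close>

definition partial_deriv :: "'a::euclidean_space \<Rightarrow> ('a \<Rightarrow> real) \<Rightarrow> 'a \<Rightarrow> real" where
  "partial_deriv b f x = deriv (\<lambda>t. f (x + t *\<^sub>R b)) 0"

text \<open>
  \<open>f \<in> C\<^sup>\<infinity>(U, \<real>)\<close>: the iterated partial derivatives of all orders, along all sequences \<open>bs\<close> of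
  coordinate directions, exist and are continuous on \<open>U\<close>. The existence conjunct is needed because
  \<open>deriv\<close> is total.
\<close>

definition C_infinity_on :: "'a::euclidean_space set \<Rightarrow> ('a \<Rightarrow> real) \<Rightarrow> bool" where
  "C_infinity_on U f \<longleftrightarrow>
     (\<forall>bs. set bs \<subseteq> Basis \<longrightarrow>
        continuous_on U (foldr partial_deriv bs f) \<and>
        (\<forall>b\<in>Basis. \<forall>x\<in>U.
           (\<lambda>t. foldr partial_deriv bs f (x + t *\<^sub>R b)) field_differentiable (at 0)))"

text \<open>
  A multi-index is a map \<open>\<nu>\<close> of which only the values on \<open>Basis\<close> are used. The coordinate
  directions are put in an arbitrary but fixed order \<open>bs\<close>; for \<open>C\<^sup>\<infinity>\<close> functions the order of
  differentiation does not matter.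
\<close>

definition multi_order :: "('a::euclidean_space \<Rightarrow> nat) \<Rightarrow> nat" where
  "multi_order \<nu> = (\<Sum>b\<in>Basis. \<nu> b)"

definition multi_deriv :: "('a::euclidean_space \<Rightarrow> nat) \<Rightarrow> ('a \<Rightarrow> real) \<Rightarrow> 'a \<Rightarrow> real" where
  "multi_deriv \<nu> f =
     foldr (\<lambda>b. partial_deriv b ^^ \<nu> b) (SOME bs. distinct bs \<and> set bs = Basis) f"

text \<open>
  \<open>box 0 One\<close> is the open unit cube \<open>(0,1)\<^sup>m\<close>. The power is \<open>powr\<close> because the exponent \<open>C + 1\<close>
  is real; its base is a factorial, hence positive.
\<close>

definition mild :: "real \<Rightarrow> real \<Rightarrow> real \<Rightarrow> 'a::euclidean_space set \<Rightarrow> ('a \<Rightarrow> real) \<Rightarrow> bool" where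
  "mild A B C U f \<longleftrightarrow>
     A > 0 \<and> B > 0 \<and> C \<ge> 0 \<and> open U \<and> U \<subseteq> box 0 One \<and> C_infinity_on U f \<and>
     (\<forall>x\<in>U. \<forall>\<nu>. \<bar>multi_deriv \<nu> f x\<bar>
        \<le> B * A ^ multi_order \<nu> * fact (multi_order \<nu>) powr (C + 1))"

definition P_map :: "real \<Rightarrow> real \<Rightarrow> real" where
  "P_map \<alpha> x = exp (1 - x powr (- \<alpha>))"

end

theory Submission
  imports Defs "HOL-Complex_Analysis.Complex_Analysis"
begin

text \<open>
  The bound comes from Cauchy's inequality. The map extends to the function
  \<open>F z = exp (1 - z powr (- \<alpha>))\<close>, holomorphic on the right half-plane, and its real derivatives
  are the real parts of the complex derivatives of \<open>F\<close>. On a disc around \<open>x > 0\<close> of radius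
  \<open>\<delta> * x\<close> with \<open>\<delta> = 1 / (2 * max \<alpha> 1)\<close> the argument of \<open>z\<close> is so small that \<open>\<alpha>\<close> times it stays
  within \<open>[-1, 1]\<close>, where the cosine is at least \<open>1/2\<close>. As moreover \<open>norm z \<le> (1 + \<delta>) * x\<close>, this
  gives \<open>Re (z powr (- \<alpha>)) \<ge> w / 2\<close> for \<open>w = ((1 + \<delta>) * x) powr (- \<alpha>)\<close> (lemma \<open>Re_powr_neg_ge\<close>),
  and Cauchy's inequality bounds the \<open>n\<close>-th derivative by
  \<open>exp 1 * fact n * exp (- w / 2) / (\<delta> * x) ^ n\<close>.

  The factor \<open>x ^ n\<close> in the denominator is beaten by the exponential at the price of a power of
  \<open>fact n\<close>: with \<open>y = \<alpha> * w / 2\<close>, the inequality \<open>y ^ n \<le> fact n * exp y\<close> raised to the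
  power \<open>1 / \<alpha>\<close> bounds \<open>exp (- w / 2) / x ^ n\<close> by \<open>fact n powr (1 / \<alpha>)\<close> times the \<open>n\<close>-th power of
  \<open>(1 + \<delta>) * (2 / \<alpha>) powr (1 / \<alpha>)\<close>. Altogether \<open>F\<close> satisfies the mildness estimate with exponent
  \<open>1 / \<alpha> + 1\<close> and constant \<open>(1 + \<delta>) / \<delta> * (2 / \<alpha>) powr (1 / \<alpha>)\<close>
  (lemma \<open>norm_higher_deriv_P_cmap_le\<close>). For \<open>\<alpha> < 1\<close> this is exactly the constant claimed, and for
  \<open>\<alpha> \<ge> 1\<close> it is at most \<open>(1 + 2 * \<alpha>) * 2 \<le> 6 * \<alpha>\<close>.
\<close>

section \<open>Estimates for real functions and for complex powers\<close>

lemma abs_arctan_le_abs: "\<bar>arctan t\<bar> \<le> \<bar>t\<bar>"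
proof -
  have "norm (arctan t - arctan 0) \<le> 1 * norm (t - 0)"
    by (rule field_differentiable_bound[of UNIV _ "\<lambda>u. inverse (1 + u\<^sup>2)"])
       (auto intro!: derivative_eq_intros simp: inverse_le_1_iff)
  then show ?thesis by simp
qed

lemma power_le_fact_exp:
  fixes y :: real
  assumes "y \<ge> 0"
  shows "y ^ n \<le> fact n * exp y"
proof -
  have "(\<Sum>k\<in>{n}. y ^ k / fact k) \<le> (\<Sum>k. y ^ k / fact k)"
    by (rule sum_le_suminf) (use assms summable_exp_generic[of y] in \<open>auto simp: divide_inverse ac_simps\<close>)
  then have "y ^ n / fact n \<le> exp y"
    by (simp add: exp_def divide_inverse ac_simps)
  then show ?thesis
    by (simp add: field_simps)
qed

text \<open>
  The real part is \<open>norm z powr (- \<alpha>) * cos (\<alpha> * Arg z)\<close>. The triangle inequality controls the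
  modulus. For the argument, \<open>\<delta> \<le> 1/2\<close> gives \<open>Re z \<ge> x / 2\<close>, so that
  \<open>\<bar>Arg z\<bar> \<le> \<bar>Im z\<bar> / Re z \<le> 2 * \<delta>\<close>; then \<open>\<alpha> * \<delta> \<le> 1/2\<close> keeps \<open>\<alpha> * Arg z\<close> within \<open>pi / 3\<close>.
\<close>

lemma Re_powr_neg_ge:
  fixes \<alpha> \<delta> x :: real and z :: complex
  assumes "\<alpha> > 0" "\<delta> \<le> 1/2" "\<alpha> * \<delta> \<le> 1/2" "x > 0"
    and z: "norm (z - of_real x) \<le> \<delta> * x"
  shows "Re z > 0" and "((1 + \<delta>) * x) powr (- \<alpha>) / 2 \<le> Re (z powr of_real (- \<alpha>))"
proof -
  have im: "\<bar>Im z\<bar> \<le> \<delta> * x"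
    using z abs_Im_le_cmod[of "z - of_real x"] by simp
  have "x - Re z \<le> \<delta> * x"
    using z abs_Re_le_cmod[of "z - of_real x"] by simp
  moreover have "\<delta> * x \<le> 1/2 * x"
    using assms by (intro mult_right_mono) auto
  ultimately have re: "x / 2 \<le> Re z" by simp
  then show Re: "Re z > 0" using \<open>x > 0\<close> by simp
  then have "z \<noteq> 0" by auto
  have nz: "norm z \<le> (1 + \<delta>) * x"
    using norm_triangle_ineq[of "z - of_real x" "of_real x"] z \<open>x > 0\<close>
    by (simp add: algebra_simps)
  have "\<bar>Im z / Re z\<bar> \<le> (\<delta> * x) / (x / 2)"
    unfolding abs_divide using im re Re \<open>x > 0\<close> by (intro frac_le) auto
  also have "\<dots> = 2 * \<delta>" using \<open>x > 0\<close> by simp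
  finally have "\<bar>Arg z\<bar> \<le> 2 * \<delta>"
    using abs_arctan_le_abs[of "Im z / Re z"] arg_conv_arctan[OF Re] by simp
  then have "\<alpha> * \<bar>Arg z\<bar> \<le> \<alpha> * (2 * \<delta>)" 
    using \<open>\<alpha> > 0\<close> by (intro mult_left_mono) auto
  also have "\<dots> \<le> pi / 3" using assms pi_gt3 by simp
  finally have "cos (pi / 3) \<le> cos (\<alpha> * \<bar>Arg z\<bar>)"
    using \<open>\<alpha> > 0\<close> pi_gt_zero by (intro cos_monotone_0_pi_le) auto
  then have cos: "1 / 2 \<le> cos (\<alpha> * Arg z)"
    by (cases "Arg z \<ge> 0") (simp_all add: cos_60)
  have "Re (z powr of_real (- \<alpha>)) = exp (- \<alpha> * ln (norm z)) * cos (- (\<alpha> * Arg z))"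
    using \<open>z \<noteq> 0\<close> by (simp add: powr_def Re_exp Arg_eq_Im_Ln)
  then have eq: "Re (z powr of_real (- \<alpha>)) = norm z powr (- \<alpha>) * cos (\<alpha> * Arg z)"
    using \<open>z \<noteq> 0\<close> by (simp add: powr_def)
  have "((1 + \<delta>) * x) powr (- \<alpha>) * (1 / 2) \<le> norm z powr (- \<alpha>) * cos (\<alpha> * Arg z)"
    using cos nz \<open>z \<noteq> 0\<close> \<open>\<alpha> > 0\<close> by (intro mult_mono powr_mono2') auto
  then show "((1 + \<delta>) * x) powr (- \<alpha>) / 2 \<le> Re (z powr of_real (- \<alpha>))"
    using eq by simp
qed

section \<open>The Cauchy estimate for the holomorphic extension\<close>

definition P_cmap :: "real \<Rightarrow> complex \<Rightarrow> complex" where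
  "P_cmap \<alpha> z = exp (1 - z powr of_real (- \<alpha>))"

lemma P_cmap_holomorphic: "P_cmap \<alpha> holomorphic_on {z. Re z > 0}"
  unfolding P_cmap_def
  by (intro holomorphic_intros) (auto simp: complex_nonpos_Reals_iff)

lemma Re_P_cmap_of_real:
  assumes "x > 0"
  shows "Re (P_cmap \<alpha> (of_real x)) = P_map \<alpha> x"
proof -
  have "P_cmap \<alpha> (of_real x) = of_real (P_map \<alpha> x)"
    using assms powr_of_real[of x "- \<alpha>"]
    by (simp add: P_cmap_def P_map_def flip: exp_of_real)
  then show ?thesis by simp
qed

text \<open>
  Larger \<open>\<delta>\<close> improves the factor \<open>(1 + \<delta>) / \<delta>\<close>; the two upper bounds on \<open>\<delta>\<close> guarantee that
  \<open>P_cmap \<alpha>\<close> still decays on the whole circle of radius \<open>\<delta> * x\<close>. That radius is proportional to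
  \<open>x\<close>, and the powers of \<open>x\<close> this costs are absorbed by the decay, uniformly in \<open>x\<close>.
\<close>

lemma norm_higher_deriv_P_cmap_le:
  fixes \<alpha> \<delta> x :: real
  assumes "\<alpha> > 0" "0 < \<delta>" "\<delta> \<le> 1/2" "\<alpha> * \<delta> \<le> 1/2" "x > 0"
  shows "norm ((deriv ^^ n) (P_cmap \<alpha>) (of_real x))
         \<le> exp 1 * ((1 + \<delta>) / \<delta> * (2 / \<alpha>) powr (1 / \<alpha>)) ^ n * fact n powr (1 / \<alpha> + 1)"
proof -
  define w where "w = ((1 + \<delta>) * x) powr (- \<alpha>)"
  have right: "Re z > 0" if "norm (z - of_real x) \<le> \<delta> * x" for z
    using Re_powr_neg_ge(1)[OF _ _ _ _ that, of \<alpha>] assms by auto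
  have sub: "cball (of_real x) (\<delta> * x) \<subseteq> {z. Re z > 0}"
    using right by (auto simp: dist_norm norm_minus_commute)
  have "norm (P_cmap \<alpha> z) \<le> exp (1 - w / 2)" if "norm (of_real x - z) = \<delta> * x" for z
    using Re_powr_neg_ge(2)[of \<alpha> \<delta> x z] that assms
    by (simp add: P_cmap_def w_def norm_minus_commute)
  moreover have "P_cmap \<alpha> holomorphic_on ball (of_real x) (\<delta> * x)"
    by (rule holomorphic_on_subset[OF P_cmap_holomorphic]) (use sub ball_subset_cball in blast)
  moreover have "continuous_on (cball (of_real x) (\<delta> * x)) (P_cmap \<alpha>)"
    by (rule holomorphic_on_imp_continuous_on[OF holomorphic_on_subset[OF P_cmap_holomorphic sub]])
  ultimately have cauchy: "norm ((deriv ^^ n) (P_cmap \<alpha>) (of_real x))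
      \<le> fact n * exp (1 - w / 2) / (\<delta> * x) ^ n"
    using assms by (intro Cauchy_inequality) auto
  have "w > 0" using assms by (simp add: w_def)
  have w_root: "w powr (1 / \<alpha>) = 1 / ((1 + \<delta>) * x)"
    using assms powr_powr[of "(1 + \<delta>) * x" "- \<alpha>" "1 / \<alpha>"]
    by (simp add: w_def powr_neg_one del: powr_powr)
  \<comment> \<open>The left-hand side is a constant to the power \<open>n\<close> times \<open>1 / x ^ n\<close>, because
      \<open>w powr (1 / \<alpha>)\<close> is proportional to \<open>1 / x\<close>.\<close>
  have "((\<alpha> * w / 2) ^ n) powr (1 / \<alpha>) \<le> (fact n * exp (\<alpha> * w / 2)) powr (1 / \<alpha>)"
    using power_le_fact_exp[of "\<alpha> * w / 2" n] assms \<open>w > 0\<close> by (intro powr_mono2) auto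
  also have "\<dots> = fact n powr (1 / \<alpha>) * exp (w / 2)"
    using assms by (simp add: powr_mult exp_powr_real)
  also have "((\<alpha> * w / 2) ^ n) powr (1 / \<alpha>) = ((\<alpha> * w / 2) powr (1 / \<alpha>)) ^ n"
    using assms \<open>w > 0\<close> by (simp add: powr_powr mult.commute flip: powr_realpow)
  also have "(\<alpha> * w / 2) powr (1 / \<alpha>) = w powr (1 / \<alpha>) / (2 / \<alpha>) powr (1 / \<alpha>)"
    using assms \<open>w > 0\<close> by (simp add: powr_mult powr_divide)
  also have "w powr (1 / \<alpha>) / (2 / \<alpha>) powr (1 / \<alpha>)
      = (1 / x) / ((1 + \<delta>) * (2 / \<alpha>) powr (1 / \<alpha>))"
    unfolding w_root by simp
  finally have "(1 / x) ^ n / ((1 + \<delta>) * (2 / \<alpha>) powr (1 / \<alpha>)) ^ n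
      \<le> fact n powr (1 / \<alpha>) * exp (w / 2)"
    by (simp only: power_divide)
  moreover have "0 < ((1 + \<delta>) * (2 / \<alpha>) powr (1 / \<alpha>)) ^ n"
    using assms by simp
  ultimately have "(1 / x) ^ n * exp (- (w / 2))
      \<le> ((1 + \<delta>) * (2 / \<alpha>) powr (1 / \<alpha>)) ^ n * fact n powr (1 / \<alpha>)"
    by (simp add: pos_divide_le_eq exp_minus mult_ac flip: divide_inverse)
  then have "exp 1 * fact n * (1 / \<delta>) ^ n * ((1 / x) ^ n * exp (- (w / 2)))
      \<le> exp 1 * fact n * (1 / \<delta>) ^ n *
        (((1 + \<delta>) * (2 / \<alpha>) powr (1 / \<alpha>)) ^ n * fact n powr (1 / \<alpha>))"
    using assms by (intro mult_left_mono) auto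
  moreover have "exp 1 * fact n * (1 / \<delta>) ^ n * ((1 / x) ^ n * exp (- (w / 2)))
      = fact n * exp (1 - w / 2) / (\<delta> * x) ^ n"
    using exp_add[of 1 "- (w / 2)"] by (simp add: power_mult_distrib power_divide)
  moreover have "exp 1 * fact n * (1 / \<delta>) ^ n *
        (((1 + \<delta>) * (2 / \<alpha>) powr (1 / \<alpha>)) ^ n * fact n powr (1 / \<alpha>))
      = exp 1 * ((1 + \<delta>) / \<delta> * (2 / \<alpha>) powr (1 / \<alpha>)) ^ n * fact n powr (1 / \<alpha> + 1)"
    by (simp add: powr_add power_mult_distrib power_divide)
  ultimately show ?thesis using cauchy by linarith
qed

section \<open>Real derivatives of the restriction of a holomorphic function\<close>

lemma has_real_derivative_Re_of_real:
  assumes "(F has_field_derivative F') (at (of_real x))"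
    and "eventually (\<lambda>y. g y = Re (F (of_real y))) (nhds x)"
  shows "(g has_real_derivative Re F') (at x)"
proof -
  have "((\<lambda>y. F (of_real y)) has_vector_derivative F') (at x)"
    using assms(1) by (rule has_vector_derivative_real_field)
  then have "((\<lambda>y. Re (F (of_real y))) has_real_derivative Re F') (at x)"
    by (rule has_field_derivative_Re)
  then show ?thesis
    using assms(2) by (subst DERIV_cong_ev[OF refl _ refl])
qed

text \<open>
  Taking real parts commutes with differentiation along the real axis. The first claim alone would
  not suffice for smoothness, as \<open>partial_deriv\<close> has a value also where the derivative does not
  exist; the second one provides existence.
\<close>

lemma iterated_partial_deriv_eq_Re:
  assumes hol: "F holomorphic_on {z. Re z > 0}"
    and f: "\<And>x. x > 0 \<Longrightarrow> f x = Re (F (of_real x))" and "x > 0"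
  shows "(partial_deriv (1::real) ^^ n) f x = Re ((deriv ^^ n) F (of_real x))"
    and "((partial_deriv (1::real) ^^ n) f has_real_derivative
           Re ((deriv ^^ Suc n) F (of_real x))) (at x)"
proof -
  have op: "open {z. Re z > 0}" by (rule open_halfspace_Re_gt)
  have D: "(g has_real_derivative Re ((deriv ^^ Suc m) F (of_real y))) (at y)"
    if "\<And>x. x > 0 \<Longrightarrow> g x = Re ((deriv ^^ m) F (of_real x))" "y > 0" for g m y
  proof (rule has_real_derivative_Re_of_real)
    show "((deriv ^^ m) F has_field_derivative (deriv ^^ Suc m) F (of_real y)) (at (of_real y))"
      using holomorphic_derivI[OF holomorphic_higher_deriv[OF hol op] op, of "of_real y"] \<open>y > 0\<close>
      by simp
    show "eventually (\<lambda>x. g x = Re ((deriv ^^ m) F (of_real x))) (nhds y)"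
      using that eventually_nhds_in_open[of "{0<..}" y] by (auto elim!: eventually_mono)
  qed
  have eq: "(partial_deriv (1::real) ^^ n) f x = Re ((deriv ^^ n) F (of_real x))" if "x > 0" for x n
    using that
  proof (induction n arbitrary: x)
    case 0
    then show ?case using f by simp
  next
    case (Suc n)
    have "((partial_deriv 1 ^^ n) f has_real_derivative
             Re ((deriv ^^ Suc n) F (of_real x))) (at x)"
      by (rule D) (use Suc in auto)
    then have "((\<lambda>t. (partial_deriv 1 ^^ n) f (x + t)) has_real_derivative
             Re ((deriv ^^ Suc n) F (of_real x))) (at 0)"
      using DERIV_shift[of "(partial_deriv 1 ^^ n) f" _ 0 x] by (simp add: add.commute)
    then show ?case
      by (simp add: partial_deriv_def[of 1 "(partial_deriv 1 ^^ n) f"] DERIV_imp_deriv)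
  qed
  show "(partial_deriv (1::real) ^^ n) f x = Re ((deriv ^^ n) F (of_real x))"
    using eq \<open>x > 0\<close> .
  show "((partial_deriv (1::real) ^^ n) f has_real_derivative
           Re ((deriv ^^ Suc n) F (of_real x))) (at x)"
    by (rule D) (use eq \<open>x > 0\<close> in auto)
qed

lemma foldr_const: "set bs \<subseteq> {b} \<Longrightarrow> foldr g bs = g b ^^ length bs"
  by (induction bs) auto

lemma C_infinity_on_of_holomorphic:
  fixes U :: "real set"
  assumes "F holomorphic_on {z. Re z > 0}"
    and "\<And>x. x > 0 \<Longrightarrow> f x = Re (F (of_real x))" and "U \<subseteq> {0<..}"
  shows "C_infinity_on U f"
  unfolding C_infinity_on_def
proof (intro allI impI conjI ballI)
  fix bs :: "real list"
  assume "set bs \<subseteq> Basis"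
  then have fold: "foldr partial_deriv bs f = (partial_deriv 1 ^^ length bs) f"
    using foldr_const[of bs 1 partial_deriv] by simp
  have D: "(foldr partial_deriv bs f has_real_derivative
             Re ((deriv ^^ Suc (length bs)) F (of_real x))) (at x)" if "x \<in> U" for x
    unfolding fold using assms that by (intro iterated_partial_deriv_eq_Re(2)) auto
  show "continuous_on U (foldr partial_deriv bs f)"
    by (intro continuous_at_imp_continuous_on ballI DERIV_isCont[OF D])
  fix b x :: real
  assume "b \<in> Basis" "x \<in> U"
  then show "(\<lambda>t. foldr partial_deriv bs f (x + t *\<^sub>R b)) field_differentiable (at 0)"
    using DERIV_shift[of "foldr partial_deriv bs f" _ 0 x] D[of x]
    by (auto simp: field_differentiable_def add.commute)
qed

lemma multi_deriv_real: "multi_deriv \<nu> f = (partial_deriv (1::real) ^^ multi_order \<nu>) f"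
proof -
  have "distinct bs \<and> set bs = Basis \<longleftrightarrow> bs = [1::real]" for bs
    by (cases bs rule: list.exhaust; cases "tl bs") (auto simp: subset_singleton_iff)
  then show ?thesis
    by (simp add: multi_deriv_def multi_order_def)
qed

section \<open>The mildness constants\<close>

lemma radius_constant_le:
  fixes \<alpha> :: real
  assumes "\<alpha> > 0"
  defines "\<delta> \<equiv> 1 / (2 * max \<alpha> 1)"
  shows "(1 + \<delta>) / \<delta> * (2 / \<alpha>) powr (1 / \<alpha>)
         \<le> (if \<alpha> \<ge> 1 then 6 * \<alpha> else 3 * (2 / \<alpha>) powr (1 / \<alpha>))"
proof (cases "\<alpha> \<ge> 1")
  case True
  have "(2 / \<alpha>) powr (1 / \<alpha>) \<le> 2 powr (1 / \<alpha>)"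
    using True by (intro powr_mono2) (auto simp: field_simps)
  also have "\<dots> \<le> 2 powr 1"
    using True by (intro powr_mono) auto
  finally have "(2 / \<alpha>) powr (1 / \<alpha>) \<le> 2" by simp
  then have "(1 + 2 * \<alpha>) * (2 / \<alpha>) powr (1 / \<alpha>) \<le> (3 * \<alpha>) * 2"
    using True by (intro mult_mono) auto
  moreover have "(1 + \<delta>) / \<delta> = 1 + 2 * \<alpha>"
    using True by (simp add: \<delta>_def field_simps)
  ultimately show ?thesis
    using True by simp
next
  case False
  then show ?thesis by (simp add: \<delta>_def)
qed

theorem proposition3p4:
  fixes \<alpha> :: real
  assumes "\<alpha> > 0"
  shows "P_map \<alpha> \<in> {0<..<1} \<rightarrow> {0<..<1} \<and>
         mild (if \<alpha> \<ge> 1 then 6 * \<alpha> else 3 * (2 / \<alpha>) powr (1 / \<alpha>)) (exp 1) (1 / \<alpha>)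
           {0<..<1} (P_map \<alpha>)"
proof
  have "x powr (- \<alpha>) > 1" if "0 < x" "x < 1" for x
    using that assms powr_less_mono2_neg[of "- \<alpha>" x 1] by simp
  then show "P_map \<alpha> \<in> {0<..<1} \<rightarrow> {0<..<1}"
    by (auto simp: P_map_def)
next
  define A where "A = (if \<alpha> \<ge> 1 then 6 * \<alpha> else 3 * (2 / \<alpha>) powr (1 / \<alpha>))"
  \<comment> \<open>The largest value with \<open>\<delta> \<le> 1/2\<close> and \<open>\<alpha> * \<delta> \<le> 1/2\<close>.\<close>
  define \<delta> where "\<delta> = 1 / (2 * max \<alpha> 1)"
  have \<delta>: "0 < \<delta>" "\<delta> \<le> 1/2" "\<alpha> * \<delta> \<le> 1/2"
    by (auto simp: \<delta>_def field_simps max_def)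
  have smooth: "C_infinity_on {0<..<1} (P_map \<alpha>)"
    by (rule C_infinity_on_of_holomorphic[OF P_cmap_holomorphic]) (auto simp: Re_P_cmap_of_real)
  have bound: "\<bar>multi_deriv \<nu> (P_map \<alpha>) x\<bar>
      \<le> exp 1 * A ^ multi_order \<nu> * fact (multi_order \<nu>) powr (1 / \<alpha> + 1)"
    if "x \<in> {0<..<1}" for x and \<nu> :: "real \<Rightarrow> nat"
  proof -
    let ?n = "multi_order \<nu>"
    have "\<bar>multi_deriv \<nu> (P_map \<alpha>) x\<bar> = \<bar>Re ((deriv ^^ ?n) (P_cmap \<alpha>) (of_real x))\<bar>"
      unfolding multi_deriv_real using that
      by (subst iterated_partial_deriv_eq_Re(1)[OF P_cmap_holomorphic])
         (auto simp: Re_P_cmap_of_real)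
    also have "\<dots> \<le> norm ((deriv ^^ ?n) (P_cmap \<alpha>) (of_real x))"
      by (rule abs_Re_le_cmod)
    also have "\<dots> \<le> exp 1 * ((1 + \<delta>) / \<delta> * (2 / \<alpha>) powr (1 / \<alpha>)) ^ ?n
        * fact ?n powr (1 / \<alpha> + 1)"
      using norm_higher_deriv_P_cmap_le[OF assms \<delta>] that by simp
    also have "\<dots> \<le> exp 1 * A ^ ?n * fact ?n powr (1 / \<alpha> + 1)"
      using radius_constant_le[OF assms] \<delta>(1)
      by (intro mult_right_mono mult_left_mono power_mono) (auto simp: A_def \<delta>_def)
    finally show ?thesis .
  qed
  have "A > 0" using assms by (simp add: A_def)
  then have "mild A (exp 1) (1 / \<alpha>) {0<..<1} (P_map \<alpha>)"
    unfolding mild_def using assms smooth bound by (auto simp: box_real)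
  then show "mild (if \<alpha> \<ge> 1 then 6 * \<alpha> else 3 * (2 / \<alpha>) powr (1 / \<alpha>)) (exp 1) (1 / \<alpha>)
      {0<..<1} (P_map \<alpha>)"
    by (simp only: A_def)
qed

end
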